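(* Let $X:\mathbb{R}^3\to\mathbb{R}^3$ be the constant vector field $X(x,y,z)=(0,0,1)$. Let $\delta>0$, $h>0$, and consider the cylinder $C=\partial B_\delta(0,0)\times[0,h]\subset\mathbb{R}^3$. Let $\xi$ be given with $0<\xi<\delta$. Then to each pair of points $p\in\partial B_\delta(0,0)\times\{0\}$ and $q\in\partial B_\delta(0,0)\times\{h\}$ one can associate a $C^\infty$ vector field $Z=Z_{p,q}$ on $\mathbb{R}^3$ such that, denoting by $\theta$ the angle between the vectors $p-(0,0,0)$ and $q-(0,0,h)$: 1. $Z$ preserves the canonical volume form $dx\wedge dy\wedge dz$; 2. $Z\equiv X$ outside the cylinder ring $A_\xi(C)$; 3. the positive orbit of $p$ with respect to $Z$ contains $q$; 4. given $r\in\mathbb{N}$ and $\epsilon>0$, if $|\theta|$ is small enough (depending only on $r,\epsilon,\delta,h,\xi$), then $\|Z-X\|_r<\epsilon$.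
   Context: $B_\delta(x,y)\subset\mathbb{R}^2$ is the open ball with center $(x,y)$ and radius $\delta$, and $B_\delta[x,y]$ is the closed ball. For the cylinder $C=\partial B_\delta(x,y)\times[0,h]$ and $0<\xi<\delta$, the cylinder ring with center at $C$ and radius $\xi$ is $A_\xi(C)=\big(B_{\delta+\xi}(x,y)\setminus B_{\delta-\xi}[x,y]\big)\times[0,h]\subset\mathbb{R}^3$. $\|\cdot\|_r$ denotes the $C^r$ norm on vector fields (supremum of all partial derivatives up to order $r$). The positive orbit of $p$ is its forward orbit under the flow of $Z$. *)

theory Defs
  imports "HOL-Analysis.Analysis"
begin

definition horizontal :: "real^3 \<Rightarrow> real^2" where
  "horizontal p = vector [p $ 1, p $ 2]"

text \<open>The product \<open>S \<times> I\<close> of a set in the plane and a set of heights, inside \<^typ>\<open>real^3\<close>.\<close>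

definition cylindrical :: "(real^2) set \<Rightarrow> real set \<Rightarrow> (real^3) set" where
  "cylindrical S I = {p. horizontal p \<in> S \<and> p $ 3 \<in> I}"

text \<open>The ring centred at the cylinder \<open>frontier (ball c \<delta>) \<times> [0,h]\<close>, of radius \<open>\<xi>\<close>.\<close>

definition cylinder_ring :: "real^2 \<Rightarrow> real \<Rightarrow> real \<Rightarrow> real \<Rightarrow> (real^3) set" where
  "cylinder_ring c \<delta> h \<xi> = cylindrical (ball c (\<delta> + \<xi>) - cball c (\<delta> - \<xi>)) {0..h}"

definition partial_deriv :: "3 \<Rightarrow> (real^3 \<Rightarrow> real^3) \<Rightarrow> real^3 \<Rightarrow> real^3" where
  "partial_deriv i f x = frechet_derivative f (at x) (axis i 1)"

primrec iter_partial :: "3 list \<Rightarrow> (real^3 \<Rightarrow> real^3) \<Rightarrow> real^3 \<Rightarrow> real^3" where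
  "iter_partial [] f = f"
| "iter_partial (i # is) f = partial_deriv i (iter_partial is f)"

text \<open>Differentiability of all iterated partial derivatives makes each of them continuous,
  so this is the class of \<open>C\<^sup>\<infinity>\<close> maps.\<close>

definition smooth_field :: "(real^3 \<Rightarrow> real^3) \<Rightarrow> bool" where
  "smooth_field f \<longleftrightarrow> (\<forall>is x. iter_partial is f differentiable (at x))"

text \<open>Extended-real-valued, so that a field with an unbounded partial derivative has norm \<open>\<infinity>\<close>.\<close>

definition Cr_norm :: "nat \<Rightarrow> (real^3 \<Rightarrow> real^3) \<Rightarrow> ereal" where
  "Cr_norm r f = (SUP (is, x) \<in> {is. length is \<le> r} \<times> UNIV. ereal (norm (iter_partial is f x)))"

text \<open>A global flow. For a smooth field it is unique if it exists, and it does exist for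
  a smooth field that is constant outside a bounded set.\<close>

definition is_flow :: "(real^3 \<Rightarrow> real^3) \<Rightarrow> (real \<Rightarrow> real^3 \<Rightarrow> real^3) \<Rightarrow> bool" where
  "is_flow Z \<phi> \<longleftrightarrow>
     (\<forall>x. \<phi> 0 x = x \<and> (\<forall>t. ((\<lambda>s. \<phi> s x) has_vector_derivative Z (\<phi> t x)) (at t)))"

definition positive_orbit :: "(real^3 \<Rightarrow> real^3) \<Rightarrow> real^3 \<Rightarrow> (real^3) set" where
  "positive_orbit Z p = {\<phi> t p | \<phi> t. is_flow Z \<phi> \<and> 0 \<le> t}"

text \<open>The form \<open>dx \<and> dy \<and> dz\<close>, whose value does not depend on the base point.\<close>

definition volume_form :: "real^3 \<Rightarrow> real^3 \<Rightarrow> real^3 \<Rightarrow> real" where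
  "volume_form u v w = det (vector [u, v, w] :: real^3^3)"

text \<open>The pullback of the volume form under each time-\<open>t\<close> map of the flow is the volume form.\<close>

definition preserves_volume_form :: "(real^3 \<Rightarrow> real^3) \<Rightarrow> bool" where
  "preserves_volume_form Z \<longleftrightarrow>
     (\<exists>\<phi>. is_flow Z \<phi> \<and>
       (\<forall>t x. \<phi> t differentiable (at x) \<and>
         (\<forall>u v w. volume_form (frechet_derivative (\<phi> t) (at x) u)
                              (frechet_derivative (\<phi> t) (at x) v)
                              (frechet_derivative (\<phi> t) (at x) w) = volume_form u v w)))"

definition vec_angle :: "real^3 \<Rightarrow> real^3 \<Rightarrow> real" where
  "vec_angle u v = arccos (u \<bullet> v / (norm u * norm v))"

end

theory Submission
  imports Defs
begin

text \<open>
  The field is \<open>Z = X + \<theta> W\<close>, where \<open>\<theta>\<close> is the signed angle from \<open>p\<close> to \<open>q\<close> and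
  \<open>W = a(x\<^sup>2 + y\<^sup>2) b(z) (-y, x, 0)\<close> rotates the level circles about the vertical axis. The two
  profiles are bump functions: \<open>a\<close> vanishes unless \<open>\<delta> - \<xi> < sqrt (x\<^sup>2 + y\<^sup>2) < \<delta> + \<xi>\<close> and \<open>b\<close> vanishes
  unless \<open>0 < z < h\<close>, so \<open>Z = X\<close> off the ring. They are scaled so that
  \<open>a(\<delta>\<^sup>2)\<close> times the integral of \<open>b\<close> over \<open>[0,h]\<close> is \<open>1\<close>.

  Along an orbit \<open>x\<^sup>2 + y\<^sup>2\<close> is constant and \<open>z\<close> grows with unit speed, so the flow is explicit: with
  an antiderivative \<open>B\<close> of \<open>b\<close>, the time-\<open>t\<close> map raises the point by \<open>t\<close> and turns it by the angle
  \<open>\<theta> a(x\<^sup>2 + y\<^sup>2) (B(z + t) - B(z))\<close> (\<open>twist_flow_is_flow\<close>). Hence the point \<open>p\<close> is turned by exactly \<open>\<theta>\<close>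
  while rising from height \<open>0\<close> to height \<open>h\<close>, and arrives at \<open>q\<close>. The turning angle depends only on
  the distance to the axis and the height; its gradient in the plane is radial, whereas changing the
  angle moves the point tangentially. This shear does not change volumes
  (\<open>volume_form_twist_differential\<close>).

  Finally \<open>Z - X = \<theta> W\<close> with \<open>W\<close> smooth, of compact support and independent of \<open>p\<close> and \<open>q\<close>. Its
  \<open>C\<^sup>r\<close> norm is therefore at most \<open>|\<theta>|\<close> times a constant (\<open>Cr_norm_scaleR_le\<close>).

  For smoothness, \<open>smooth_algebra\<close> is an algebra of functions that contains the coordinates and is
  closed under composition with the functions \<open>exp (- 1 / x) / x\<^sup>n\<close>, extended by \<open>0\<close> to \<open>x \<le> 0\<close>. The
  derivative of each of these is a linear combination of two others, so the algebra is closed under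
  partial derivatives, and closure together with differentiability gives derivatives of all orders.
\<close>

section \<open>A smooth function vanishing on a half-line\<close>

text \<open>The function used for cutting off is \<open>flat 0\<close>. The powers in the denominator are included
  because the family of all \<open>flat n\<close> then spans a space closed under differentiation.\<close>

definition flat :: "nat \<Rightarrow> real \<Rightarrow> real" where
  "flat n x = (if x > 0 then exp (- (1 / x)) / x ^ n else 0)"

lemma flat_nonneg: "flat n x \<ge> 0"
  by (simp add: flat_def)

lemma flat_eq_0: "x \<le> 0 \<Longrightarrow> flat n x = 0"
  by (simp add: flat_def)

text \<open>With \<open>u = 1 / x\<close>, the exponential series gives \<open>u ^ k / fact k \<le> exp u\<close> for \<open>k = n + m\<close>, and
  multiplying by \<open>x ^ m * exp (- u)\<close> bounds \<open>flat n x\<close>. So \<open>flat n\<close> vanishes at \<open>0\<close> to every order \<open>m\<close>.\<close>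

lemma flat_bound: "flat n x \<le> fact (n + m) * \<bar>x\<bar> ^ m"
proof (cases "x > 0")
  case True
  have "(1 / x) ^ (n + m) / fact (n + m) \<le> exp (1 / x)"
  proof -
    have "(\<Sum>k\<in>{n + m}. (1 / x) ^ k /\<^sub>R fact k) \<le> (\<Sum>k. (1 / x) ^ k /\<^sub>R fact k)"
      using True by (intro sum_le_suminf summable_exp_generic) auto
    then show ?thesis
      by (simp add: exp_def divide_inverse mult.commute)
  qed
  then have "exp (- (1 / x)) \<le> fact (n + m) * x ^ (n + m)"
    using True by (simp add: exp_minus field_simps)
  then have "exp (- (1 / x)) / x ^ n \<le> fact (n + m) * x ^ (n + m) / x ^ n"
    using True by (intro divide_right_mono) auto
  also have "\<dots> = fact (n + m) * x ^ m"
    using True by (simp add: power_add)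
  finally show ?thesis using True by (simp add: flat_def)
qed (simp add: flat_def)

text \<open>Away from \<open>0\<close> this is the product rule. At \<open>0\<close> the formula reads \<open>0\<close>, and the difference quotient
  tends to \<open>0\<close> because \<open>flat n\<close> vanishes there to second order.\<close>

lemma flat_has_real_derivative:
  "(flat n has_real_derivative flat (n + 2) x - real n * flat (n + 1) x) (at x)"
proof (cases x "0 :: real" rule: linorder_cases)
  case less
  have "((\<lambda>_. 0) has_real_derivative 0) (at x)" by simp
  then have "(flat n has_real_derivative 0) (at x)"
    by (rule has_field_derivative_transform_within_open[where S = "{..<0}"]) (use less in \<open>auto simp: flat_def\<close>)
  then show ?thesis using less by (simp add: flat_def)
next
  case equal
  have "((\<lambda>h. flat n h / h) \<longlongrightarrow> 0) (at 0)"
  proof (rule Lim_null_comparison)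
    have "norm (flat n h / h) \<le> fact (n + 2) * \<bar>h\<bar>" if "h \<noteq> 0" for h
    proof -
      have "flat n h \<le> (fact (n + 2) * \<bar>h\<bar>) * \<bar>h\<bar>"
        using flat_bound[of n h 2] by (simp only: power2_eq_square mult.assoc)
      then have "flat n h / \<bar>h\<bar> \<le> fact (n + 2) * \<bar>h\<bar>"
        using that by (subst pos_divide_le_eq) auto
      then show ?thesis
        by (simp only: real_norm_def abs_divide abs_of_nonneg[OF flat_nonneg])
    qed
    then show "\<forall>\<^sub>F h in at 0. norm (flat n h / h) \<le> fact (n + 2) * \<bar>h\<bar>"
      by (auto simp: eventually_at_filter)
    show "((\<lambda>h. fact (n + 2) * \<bar>h\<bar>) \<longlongrightarrow> (0::real)) (at 0)"
      by (auto intro!: tendsto_eq_intros)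
  qed
  then have "(flat n has_real_derivative 0) (at 0)"
    unfolding has_field_derivative_iff by (simp add: flat_eq_0)
  then show ?thesis using equal by (simp add: flat_eq_0)
next
  case greater
  have "((\<lambda>x. exp (- (1 / x))) has_real_derivative exp (- (1 / x)) / x\<^sup>2) (at x)"
    using greater by (auto intro!: derivative_eq_intros simp: power2_eq_square)
  moreover have "((\<lambda>x. x ^ n) has_real_derivative real n * x ^ n / x) (at x)"
    using DERIV_pow[of n x UNIV] greater by (cases n) auto
  ultimately have "((\<lambda>x. exp (- (1 / x)) / x ^ n) has_real_derivative
      (exp (- (1 / x)) / x\<^sup>2 * x ^ n - exp (- (1 / x)) * (real n * x ^ n / x)) / (x ^ n * x ^ n)) (at x)"
    using greater by (intro DERIV_divide) auto
  also have "(exp (- (1 / x)) / x\<^sup>2 * x ^ n - exp (- (1 / x)) * (real n * x ^ n / x)) / (x ^ n * x ^ n)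
      = flat (n + 2) x - real n * flat (n + 1) x"
    using greater by (simp add: flat_def power2_eq_square diff_divide_distrib)
  finally have "((\<lambda>x. exp (- (1 / x)) / x ^ n) has_real_derivative
      flat (n + 2) x - real n * flat (n + 1) x) (at x)" .
  then show ?thesis
    by (rule has_field_derivative_transform_within_open[where S = "{0<..}"]) (use greater in \<open>auto simp: flat_def\<close>)
qed

definition bump :: "real \<Rightarrow> real \<Rightarrow> real \<Rightarrow> real" where
  "bump l u s = flat 0 (s - l) * flat 0 (u - s)"

lemma bump_eq_0: "s \<notin> {l<..<u} \<Longrightarrow> bump l u s = 0"
  by (auto simp: bump_def flat_def)

lemma bump_pos: "s \<in> {l<..<u} \<Longrightarrow> bump l u s > 0"
  by (simp add: bump_def flat_def)

section \<open>An algebra of smooth functions\<close>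

text \<open>The constructors are the ingredients of the field. Closure under differentiation is not
  stipulated but proved, which is what makes membership a proof of smoothness.\<close>

inductive_set smooth_algebra :: "('a::real_inner \<Rightarrow> real) set" where
  const: "(\<lambda>_. c) \<in> smooth_algebra"
| inner: "(\<lambda>x. x \<bullet> e) \<in> smooth_algebra"
| add: "f \<in> smooth_algebra \<Longrightarrow> g \<in> smooth_algebra \<Longrightarrow> (\<lambda>x. f x + g x) \<in> smooth_algebra"
| mult: "f \<in> smooth_algebra \<Longrightarrow> g \<in> smooth_algebra \<Longrightarrow> (\<lambda>x. f x * g x) \<in> smooth_algebra"
| flat: "f \<in> smooth_algebra \<Longrightarrow> (\<lambda>x. flat n (f x)) \<in> smooth_algebra"

lemma smooth_algebra_uminus:
  "f \<in> smooth_algebra \<Longrightarrow> (\<lambda>x. - f x) \<in> smooth_algebra"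
  using smooth_algebra.mult[OF smooth_algebra.const[of "-1"]] by fastforce

lemma smooth_algebra_diff:
  "f \<in> smooth_algebra \<Longrightarrow> g \<in> smooth_algebra \<Longrightarrow> (\<lambda>x. f x - g x) \<in> smooth_algebra"
  using smooth_algebra.add[OF _ smooth_algebra_uminus] by fastforce

lemma smooth_algebra_nth:
  "(\<lambda>x::real^'n. x $ i) \<in> smooth_algebra"
  using smooth_algebra.inner[of "axis i (1::real)"] by (simp add: inner_axis)

lemma smooth_algebra_bump:
  "f \<in> smooth_algebra \<Longrightarrow> (\<lambda>x. bump l u (f x)) \<in> smooth_algebra"
  unfolding bump_def
  by (intro smooth_algebra.mult smooth_algebra.flat smooth_algebra_diff smooth_algebra.const)

text \<open>Each constructor has a differentiation rule whose result is built from constructors again: the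
  sum, product and chain rules, the last one with \<open>flat_has_real_derivative\<close> for the outer function.\<close>

lemma smooth_algebra_derivative:
  assumes "f \<in> smooth_algebra"
  shows "\<exists>f'. (\<forall>x. (f has_derivative f' x) (at x)) \<and> (\<forall>v. (\<lambda>x. f' x v) \<in> smooth_algebra)"
  using assms
proof induction
  case (const c)
  show ?case
    by (rule exI[of _ "\<lambda>x v. 0"]) (auto intro: smooth_algebra.const)
next
  case (inner e)
  show ?case
    by (rule exI[of _ "\<lambda>x v. v \<bullet> e"])
      (auto intro: smooth_algebra.const bounded_linear_imp_has_derivative bounded_linear_inner_left)
next
  case (add f g)
  then obtain f' g' where
    "\<And>x. (f has_derivative f' x) (at x)" "\<And>v. (\<lambda>x. f' x v) \<in> smooth_algebra"
    "\<And>x. (g has_derivative g' x) (at x)" "\<And>v. (\<lambda>x. g' x v) \<in> smooth_algebra"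
    by blast
  then show ?case
    by (intro exI[of _ "\<lambda>x v. f' x v + g' x v"])
      (auto intro: smooth_algebra.add has_derivative_add)
next
  case (mult f g)
  then obtain f' g' where
    "\<And>x. (f has_derivative f' x) (at x)" "\<And>v. (\<lambda>x. f' x v) \<in> smooth_algebra"
    "\<And>x. (g has_derivative g' x) (at x)" "\<And>v. (\<lambda>x. g' x v) \<in> smooth_algebra"
    by blast
  note fg' = this
  let ?d = "\<lambda>x v. f x * g' x v + f' x v * g x"
  have "((\<lambda>x. f x * g x) has_derivative ?d x) (at x)" for x
    by (rule has_derivative_mult[OF fg'(1,3)])
  moreover have "(\<lambda>x. ?d x v) \<in> smooth_algebra" for v
    by (rule smooth_algebra.add[OF smooth_algebra.mult[OF mult.hyps(1) fg'(4)]
          smooth_algebra.mult[OF fg'(2) mult.hyps(2)]])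
  ultimately show ?case
    by (intro exI[of _ ?d]) auto
next
  case (flat f n)
  then obtain f' where f':
    "\<And>x. (f has_derivative f' x) (at x)" "\<And>v. (\<lambda>x. f' x v) \<in> smooth_algebra"
    by blast
  let ?g = "\<lambda>x. flat (n + 2) (f x) - real n * flat (n + 1) (f x)"
  have "((\<lambda>x. flat n (f x)) has_derivative (\<lambda>v. ?g x * f' x v)) (at x)" for x
    using has_derivative_compose[OF f'(1) flat_has_real_derivative[unfolded has_field_derivative_def]] .
  moreover have "(\<lambda>x. ?g x * f' x v) \<in> smooth_algebra" for v
    by (intro smooth_algebra.mult smooth_algebra.flat smooth_algebra_diff smooth_algebra.const flat.hyps f')
  ultimately show ?case
    by (intro exI[of _ "\<lambda>x v. ?g x * f' x v"]) auto
qed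

lemma bump_differentiable: "bump l u differentiable (at s)"
proof -
  have "(\<lambda>s::real. bump l u (s \<bullet> 1)) \<in> smooth_algebra"
    by (intro smooth_algebra_bump smooth_algebra.inner)
  then show ?thesis
    using smooth_algebra_derivative by (fastforce simp: differentiable_def)
qed

lemma has_derivative_cart:
  fixes f :: "'a::real_normed_vector \<Rightarrow> real^'n"
  assumes "\<And>i. ((\<lambda>x. f x $ i) has_derivative (\<lambda>v. f' v $ i)) (at x)"
  shows "(f has_derivative f') (at x)"
  using assms unfolding has_derivative_componentwise_within[of f]
  by (auto simp: Basis_vec_def inner_axis)

section \<open>Iterated partial derivatives\<close>

lemma partial_deriv_eq:
  "(f has_derivative f') (at x) \<Longrightarrow> partial_deriv i f x = f' (axis i 1)"
  by (simp add: partial_deriv_def frechet_derivative_at[symmetric])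

lemma smooth_algebra_partial_deriv:
  fixes f :: "real^3 \<Rightarrow> real^3"
  assumes "\<And>i. (\<lambda>x. f x $ i) \<in> smooth_algebra"
  shows "f differentiable (at x)" and "(\<lambda>x. partial_deriv j f x $ i) \<in> smooth_algebra"
proof -
  obtain f' where f':
    "\<And>i x. ((\<lambda>x. f x $ i) has_derivative f' i x) (at x)"
    "\<And>i v. (\<lambda>x. f' i x v) \<in> smooth_algebra"
    using smooth_algebra_derivative[OF assms] by metis
  have D: "(f has_derivative (\<lambda>v. \<chi> i. f' i x v)) (at x)" for x
    by (rule has_derivative_cart) (simp add: f')
  then show "f differentiable (at x)"
    by (auto simp: differentiable_def)
  show "(\<lambda>x. partial_deriv j f x $ i) \<in> smooth_algebra"
    by (simp add: partial_deriv_eq[OF D] f')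
qed

text \<open>By induction all iterated partial derivatives have components in the algebra, and fields with
  components in the algebra are differentiable.\<close>

lemma smooth_algebra_imp_smooth_field:
  assumes "\<And>i. (\<lambda>x. f x $ i) \<in> smooth_algebra"
  shows "smooth_field f"
proof -
  have "(\<lambda>x. iter_partial is f x $ i) \<in> smooth_algebra" for "is" i
    by (induction "is" arbitrary: i) (simp_all add: assms smooth_algebra_partial_deriv)
  then show ?thesis
    by (simp add: smooth_field_def smooth_algebra_partial_deriv)
qed

lemma iter_partial_scaleR:
  assumes "smooth_field f"
  shows "iter_partial is (\<lambda>x. c *\<^sub>R f x) = (\<lambda>x. c *\<^sub>R iter_partial is f x)"
proof (induction "is")
  case (Cons i "is")
  have scaled: "((\<lambda>x. c *\<^sub>R iter_partial is f x) has_derivative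
      (\<lambda>v. c *\<^sub>R frechet_derivative (iter_partial is f) (at x) v)) (at x)" for x
    using assms by (intro has_derivative_scaleR_right)
      (simp add: smooth_field_def frechet_derivative_works[symmetric])
  then show ?case
    by (simp add: Cons fun_eq_iff partial_deriv_eq[OF scaled] partial_deriv_def)
qed simp

lemma iter_partial_eq_0_off_support:
  assumes "closed K" and "\<And>x. x \<notin> K \<Longrightarrow> f x = 0" and "x \<notin> K"
  shows "iter_partial is f x = 0"
  using assms(3)
proof (induction "is" arbitrary: x)
  case Nil
  then show ?case by (simp add: assms(2))
next
  case (Cons i "is")
  have "((\<lambda>_. 0) has_derivative (\<lambda>_. 0)) (at x)"
    by simp
  then have "(iter_partial is f has_derivative (\<lambda>_. 0)) (at x)"
    by (rule has_derivative_transform_within_open[where s = "- K"])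
      (use assms(1) Cons in auto)
  then show ?case
    by (simp add: partial_deriv_eq)
qed

text \<open>The iterated partial derivatives of \<open>c f\<close> are \<open>c\<close> times those of \<open>f\<close>, and each of these is
  continuous with support in \<open>K\<close>, hence bounded. There are finitely many of order at most \<open>r\<close>, and
  the sum of their bounds is a constant that serves for every \<open>c\<close>.\<close>

lemma Cr_norm_scaleR_le:
  assumes f: "smooth_field f" and K: "compact K" "\<And>x. x \<notin> K \<Longrightarrow> f x = 0"
  shows "\<exists>M\<ge>0. \<forall>c. Cr_norm r (\<lambda>x. c *\<^sub>R f x) \<le> ereal (\<bar>c\<bar> * M)"
proof -
  have "\<exists>M. \<forall>x. norm (iter_partial is f x) \<le> M" for "is"
  proof -
    have "continuous_on K (iter_partial is f)"
      using f by (intro continuous_at_imp_continuous_on)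
        (simp add: smooth_field_def differentiable_imp_continuous_within)
    then have "bounded (iter_partial is f ` K)"
      by (intro compact_imp_bounded compact_continuous_image K)
    then obtain M where "M > 0" "\<And>x. x \<in> K \<Longrightarrow> norm (iter_partial is f x) \<le> M"
      by (auto simp: bounded_pos)
    moreover have "iter_partial is f x = 0" if "x \<notin> K" for x
      using iter_partial_eq_0_off_support[of K f x] compact_imp_closed[OF K(1)] K(2) that by blast
    ultimately have "norm (iter_partial is f x) \<le> M" for x
      by (cases "x \<in> K") auto
    then show ?thesis by blast
  qed
  then obtain M where M: "\<And>is x. norm (iter_partial is f x) \<le> M is"
    by metis
  let ?L = "{is :: 3 list. length is \<le> r}"
  have fin: "finite ?L"
    using finite_lists_length_le[of "UNIV :: 3 set" r] by simp
  have M0: "M is \<ge> 0" for "is"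
    using M[of "is" 0] norm_ge_zero order_trans by blast
  show ?thesis
  proof (intro exI conjI allI)
    show "sum M ?L \<ge> 0" by (simp add: M0 sum_nonneg)
    fix c
    have "norm (c *\<^sub>R iter_partial is f x) \<le> \<bar>c\<bar> * sum M ?L" if "length is \<le> r" for "is" x
    proof -
      have "M is \<le> sum M ?L"
        using that fin by (intro member_le_sum) (auto simp: M0)
      then show ?thesis
        using M[of "is" x] by (simp add: mult_left_mono)
    qed
    then show "Cr_norm r (\<lambda>x. c *\<^sub>R f x) \<le> ereal (\<bar>c\<bar> * sum M ?L)"
      unfolding Cr_norm_def iter_partial_scaleR[OF f] by (intro SUP_least) auto
  qed
qed

section \<open>Twist fields\<close>

definition sqradius :: "real^3 \<Rightarrow> real" where
  "sqradius x = (x $ 1)\<^sup>2 + (x $ 2)\<^sup>2"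

definition twist_field :: "(real \<Rightarrow> real) \<Rightarrow> (real \<Rightarrow> real) \<Rightarrow> real^3 \<Rightarrow> real^3" where
  "twist_field a b x =
     vector [- (a (sqradius x) * b (x $ 3) * x $ 2), a (sqradius x) * b (x $ 3) * x $ 1, 1]"

text \<open>A screw motion: the turn by \<open>\<alpha>\<close> about the vertical axis combined with the shift by \<open>t\<close> along it.\<close>

definition rotate_lift :: "real \<Rightarrow> real \<Rightarrow> real^3 \<Rightarrow> real^3" where
  "rotate_lift \<alpha> t x =
     vector [cos \<alpha> * x $ 1 - sin \<alpha> * x $ 2, sin \<alpha> * x $ 1 + cos \<alpha> * x $ 2, x $ 3 + t]"

definition twist_flow :: "(real \<Rightarrow> real) \<Rightarrow> (real \<Rightarrow> real) \<Rightarrow> real \<Rightarrow> real^3 \<Rightarrow> real^3" where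
  "twist_flow a B t x = rotate_lift (a (sqradius x) * (B (x $ 3 + t) - B (x $ 3))) t x"

lemma sqradius_rotate_lift: "sqradius (rotate_lift \<alpha> t x) = sqradius x"
proof -
  have "(cos \<alpha> * u - sin \<alpha> * v)\<^sup>2 + (sin \<alpha> * u + cos \<alpha> * v)\<^sup>2
      = ((sin \<alpha>)\<^sup>2 + (cos \<alpha>)\<^sup>2) * (u\<^sup>2 + v\<^sup>2)" for u v :: real
    by algebra
  then show ?thesis by (simp add: sqradius_def rotate_lift_def)
qed

text \<open>The horizontal part of the field is the generator of rotations times the angular speed
  \<open>a(x\<^sup>2 + y\<^sup>2) b(z)\<close>. At time \<open>t\<close> the speed along the curve is \<open>a(x\<^sup>2 + y\<^sup>2) b(z + t)\<close> with the
  initial \<open>x\<close>, \<open>y\<close>, \<open>z\<close>, because rotations preserve \<open>x\<^sup>2 + y\<^sup>2\<close>; this is the derivative of the turning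
  angle.\<close>

lemma twist_flow_is_flow:
  assumes B: "\<And>z. (B has_real_derivative b z) (at z)"
  shows "is_flow (twist_field a b) (twist_flow a B)"
  unfolding is_flow_def
proof (intro allI conjI)
  fix x t
  show "twist_flow a B 0 x = x"
    by (simp add: twist_flow_def rotate_lift_def vec_eq_iff forall_3)
  define \<beta> where "\<beta> s = a (sqradius x) * (B (x $ 3 + s) - B (x $ 3))" for s
  have "((\<lambda>s. B (x $ 3 + s)) has_real_derivative b (x $ 3 + t)) (at t)"
    using DERIV_chain2[OF B DERIV_add[OF DERIV_const DERIV_ident]] by simp
  then have \<beta>: "(\<beta> has_real_derivative a (sqradius x) * b (x $ 3 + t)) (at t)"
    unfolding \<beta>_def by (auto intro!: derivative_eq_intros)
  define y where "y = twist_flow a B t x"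
  have flow: "twist_flow a B s x = rotate_lift (\<beta> s) s x" for s
    by (simp add: twist_flow_def \<beta>_def)
  have y: "sqradius y = sqradius x" "y $ 1 = cos (\<beta> t) * x $ 1 - sin (\<beta> t) * x $ 2"
    "y $ 2 = sin (\<beta> t) * x $ 1 + cos (\<beta> t) * x $ 2" "y $ 3 = x $ 3 + t"
    unfolding y_def flow sqradius_rotate_lift by (simp_all add: rotate_lift_def)
  have "((\<lambda>s. twist_flow a B s x $ i) has_real_derivative twist_field a b y $ i) (at t)" for i
    unfolding twist_field_def flow rotate_lift_def y using exhaust_3[of i]
    by (auto intro!: derivative_eq_intros \<beta> simp: algebra_simps)
  then show "((\<lambda>s. twist_flow a B s x) has_vector_derivative twist_field a b (twist_flow a B t x)) (at t)"
    unfolding has_vector_derivative_def y_def[symmetric]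
    by (intro has_derivative_cart) (simp add: has_field_derivative_def mult.commute[of _ "_ $ _"] mult_commute_abs)
qed

text \<open>The derivative at \<open>x\<close>, in direction \<open>v\<close>, of a screw motion whose angle varies with the point.
  Here \<open>\<omega>\<close> is the derivative of the angle; its gradient has a horizontal part radial at \<open>x\<close> (factor
  \<open>k\<close>) and a vertical part \<open>m\<close>.\<close>

definition twist_differential :: "real \<Rightarrow> real \<Rightarrow> real \<Rightarrow> real^3 \<Rightarrow> real^3 \<Rightarrow> real^3" where
  "twist_differential \<alpha> k m x v =
    (let \<omega> = k * (x $ 1 * v $ 1 + x $ 2 * v $ 2) + m * v $ 3 in
     vector [cos \<alpha> * v $ 1 - sin \<alpha> * v $ 2 - \<omega> * (sin \<alpha> * x $ 1 + cos \<alpha> * x $ 2),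
             sin \<alpha> * v $ 1 + cos \<alpha> * v $ 2 + \<omega> * (cos \<alpha> * x $ 1 - sin \<alpha> * x $ 2),
             v $ 3])"

text \<open>After undoing the rotation the map is \<open>v \<mapsto> v + \<omega>(v) J x\<close> with \<open>J x = (-y, x, 0)\<close>. Its
  determinant is \<open>1 + \<omega>(J x)\<close>, and \<open>\<omega>(J x) = 0\<close> as \<open>J x\<close> is horizontal and orthogonal to the
  radial direction. In coordinates this is a polynomial identity in which the rotation contributes
  the factor \<open>(cos \<alpha>)\<^sup>2 + (sin \<alpha>)\<^sup>2\<close>.\<close>

lemma volume_form_twist_differential:
  "volume_form (twist_differential \<alpha> k m x u) (twist_differential \<alpha> k m x v) (twist_differential \<alpha> k m x w)
    = volume_form u v w"
proof -
  have "volume_form (twist_differential \<alpha> k m x u) (twist_differential \<alpha> k m x v) (twist_differential \<alpha> k m x w)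
      = ((cos \<alpha>)\<^sup>2 + (sin \<alpha>)\<^sup>2) * volume_form u v w"
    unfolding volume_form_def det_3 vector_3 twist_differential_def Let_def by algebra
  then show ?thesis by simp
qed

lemma twist_flow_has_derivative:
  fixes a b B :: "real \<Rightarrow> real"
  assumes B: "\<And>z. (B has_real_derivative b z) (at z)"
    and a: "a differentiable (at (sqradius x))"
  obtains \<alpha> k m where "(twist_flow a B t has_derivative twist_differential \<alpha> k m x) (at x)"
proof -
  obtain a' where a': "(a has_real_derivative a') (at (sqradius x))"
    using a real_differentiable_def by blast
  define k where "k = 2 * a' * (B (x $ 3 + t) - B (x $ 3))"
  define m where "m = a (sqradius x) * (b (x $ 3 + t) - b (x $ 3))"
  have nth: "((\<lambda>x::real^3. x $ i) has_derivative (\<lambda>v. v $ i)) (at x)" for i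
    by (rule bounded_linear_imp_has_derivative[OF bounded_linear_vec_nth])
  have sq: "(sqradius has_derivative (\<lambda>v. 2 * (x $ 1 * v $ 1 + x $ 2 * v $ 2))) (at x)"
    unfolding sqradius_def by (auto intro!: derivative_eq_intros nth simp: algebra_simps)
  have a_sq: "((\<lambda>x. a (sqradius x)) has_derivative
      (\<lambda>v. a' * (2 * (x $ 1 * v $ 1 + x $ 2 * v $ 2)))) (at x)"
    using has_derivative_compose[OF sq a'[unfolded has_field_derivative_def]] .
  have B3: "((\<lambda>x. B (x $ 3 + s)) has_derivative (\<lambda>v. b (x $ 3 + s) * v $ 3)) (at x)" for s
    using has_derivative_compose[OF has_derivative_add[OF nth has_derivative_const]
        B[unfolded has_field_derivative_def]] by simp
  define \<beta> where "\<beta> y = a (sqradius y) * (B (y $ 3 + t) - B (y $ 3))" for y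
  have ang: "(\<beta> has_derivative (\<lambda>v. k * (x $ 1 * v $ 1 + x $ 2 * v $ 2) + m * v $ 3)) (at x)"
    using has_derivative_mult[OF a_sq has_derivative_diff[OF B3[of t] B3[of 0]]]
    by (simp add: \<beta>_def[abs_def] k_def m_def algebra_simps)
  have "(twist_flow a B t has_derivative twist_differential (\<beta> x) k m x) (at x)"
  proof (rule has_derivative_cart)
    fix i :: 3
    have flow: "twist_flow a B t y = rotate_lift (\<beta> y) t y" for y
      by (simp add: twist_flow_def \<beta>_def)
    note mult_nth = has_derivative_mult[OF _ nth]
    show "((\<lambda>x. twist_flow a B t x $ i) has_derivative
        (\<lambda>v. twist_differential (\<beta> x) k m x v $ i)) (at x)"
      unfolding flow rotate_lift_def twist_differential_def Let_def
      using exhaust_3[of i]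
        has_derivative_diff[OF mult_nth[OF has_derivative_cos[OF ang], of 1] mult_nth[OF has_derivative_sin[OF ang], of 2]]
        has_derivative_add[OF mult_nth[OF has_derivative_sin[OF ang], of 1] mult_nth[OF has_derivative_cos[OF ang], of 2]]
        has_derivative_add[OF nth[of 3] has_derivative_const[of t]]
      by (elim disjE) (simp_all add: algebra_simps)
  qed
  then show ?thesis by (rule that)
qed

lemma twist_field_preserves_volume:
  assumes B: "\<And>z. (B has_real_derivative b z) (at z)"
    and a: "\<And>s. a differentiable (at s)"
  shows "preserves_volume_form (twist_field a b)"
  unfolding preserves_volume_form_def
proof (intro exI conjI allI)
  show "is_flow (twist_field a b) (twist_flow a B)"
    by (rule twist_flow_is_flow[OF B])
  fix t x u v w
  obtain \<alpha> k m where D: "(twist_flow a B t has_derivative twist_differential \<alpha> k m x) (at x)"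
    using twist_flow_has_derivative[OF B a] by blast
  then show "twist_flow a B t differentiable (at x)"
    by (auto simp: differentiable_def)
  show "volume_form (frechet_derivative (twist_flow a B t) (at x) u)
        (frechet_derivative (twist_flow a B t) (at x) v)
        (frechet_derivative (twist_flow a B t) (at x) w) = volume_form u v w"
    unfolding frechet_derivative_at[OF D, symmetric] by (rule volume_form_twist_differential)
qed

section \<open>Angles between horizontal vectors of equal length\<close>

text \<open>The angle between two vectors is unsigned. The sign for the rotation comes from the cross
  product: with \<open>c\<close> and \<open>s\<close> the normalised dot and cross products, \<open>c\<^sup>2 + s\<^sup>2 = 1\<close>, so \<open>arccos c\<close> with the
  sign of \<open>s\<close> has cosine \<open>c\<close> and sine \<open>s\<close>.\<close>

lemma exists_rotation_by_vec_angle: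
  assumes u: "u $ 3 = 0" "sqradius u = d\<^sup>2" and v: "v $ 3 = 0" "sqradius v = d\<^sup>2" and d: "d > 0"
  shows "\<exists>\<theta>. \<bar>\<theta>\<bar> = \<bar>vec_angle u v\<bar> \<and> rotate_lift \<theta> t u = v + vector [0, 0, t]"
proof -
  define c where "c = (u $ 1 * v $ 1 + u $ 2 * v $ 2) / d\<^sup>2"
  define s where "s = (u $ 1 * v $ 2 - u $ 2 * v $ 1) / d\<^sup>2"
  have nrm: "norm w = d" if "w $ 3 = 0" "sqradius w = d\<^sup>2" for w :: "real^3"
    using that d by (simp add: norm_eq_sqrt_inner inner_vec_def sum_3 sqradius_def power2_eq_square)
  have ang: "vec_angle u v = arccos c"
    using u v by (simp add: vec_angle_def nrm c_def inner_vec_def sum_3 power2_eq_square)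
  have "(u $ 1 * v $ 1 + u $ 2 * v $ 2)\<^sup>2 + (u $ 1 * v $ 2 - u $ 2 * v $ 1)\<^sup>2 = sqradius u * sqradius v"
    unfolding sqradius_def by algebra
  then have cs: "c\<^sup>2 + s\<^sup>2 = 1"
    using d u v by (simp add: c_def s_def power_divide add_divide_distrib[symmetric] power2_eq_square)
  then have "c\<^sup>2 \<le> 1"
    by (metis le_add_same_cancel1 zero_le_power2)
  then have "\<bar>c\<bar> \<le> 1"
    by (simp add: abs_square_le_1)
  moreover from this have "\<bar>s\<bar> = sin (arccos c)"
    using cs by (simp add: sin_arccos_abs) (metis add_diff_cancel_left' real_sqrt_abs)
  moreover define \<theta> where "\<theta> = (if s \<ge> 0 then arccos c else - arccos c)"
  ultimately have \<theta>: "cos \<theta> = c" "sin \<theta> = s"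
    by auto
  have "c * u $ 1 - s * u $ 2 = v $ 1 * sqradius u / d\<^sup>2" "s * u $ 1 + c * u $ 2 = v $ 2 * sqradius u / d\<^sup>2"
    using d by (simp_all add: c_def s_def sqradius_def field_simps power2_eq_square)
  then have "rotate_lift \<theta> t u = v + vector [0, 0, t]"
    using u v d by (simp add: rotate_lift_def \<theta> vec_eq_iff forall_3)
  then show ?thesis
    using ang by (intro exI[of _ \<theta>]) (simp add: \<theta>_def)
qed

section \<open>The field joining the two points\<close>

lemma horizontal_norm: "(norm (horizontal x))\<^sup>2 = sqradius x"
  by (simp add: horizontal_def sqradius_def norm_eq_sqrt_inner inner_vec_def sum_2 power2_eq_square)

lemma twist_flow_joins:
  assumes B: "\<And>z. (B has_real_derivative b z) (at z)" and "h \<ge> 0"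
    and p: "p $ 3 = 0" "a (sqradius p) * (B h - B 0) = \<theta>" "rotate_lift \<theta> h p = q"
  shows "q \<in> positive_orbit (twist_field a b) p"
proof -
  have "twist_flow a B h p = q"
    using p by (simp add: twist_flow_def)
  then show ?thesis
    using twist_flow_is_flow[OF B] \<open>h \<ge> 0\<close> unfolding positive_orbit_def by blast
qed

lemma ex_antiderivative:
  fixes f :: "real \<Rightarrow> real"
  assumes "\<And>x. isCont f x"
  obtains F where "\<And>x. (F has_real_derivative f x) (at x)"
  using einterval_antiderivative[of "-\<infinity>" "\<infinity>" f] assms
  by (auto simp: has_real_derivative_iff_has_vector_derivative)

theorem lemma4p1:
  fixes X :: "real^3 \<Rightarrow> real^3" and \<delta> h \<xi> :: real
  assumes X: "X = (\<lambda>_. vector [0, 0, 1])"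
    and "\<delta> > 0" and "h > 0" and "0 < \<xi>" and "\<xi> < \<delta>"
  shows "\<exists>Z :: real^3 \<Rightarrow> real^3 \<Rightarrow> real^3 \<Rightarrow> real^3.
    (\<forall>p \<in> cylindrical (frontier (ball 0 \<delta>)) {0}. \<forall>q \<in> cylindrical (frontier (ball 0 \<delta>)) {h}.
        smooth_field (Z p q) \<and>
        preserves_volume_form (Z p q) \<and>
        (\<forall>x. x \<notin> cylinder_ring 0 \<delta> h \<xi> \<longrightarrow> Z p q x = X x) \<and>
        q \<in> positive_orbit (Z p q) p) \<and>
    (\<forall>(r::nat) (\<epsilon>::real). \<epsilon> > 0 \<longrightarrow>
      (\<exists>\<eta>>0. \<forall>p \<in> cylindrical (frontier (ball 0 \<delta>)) {0}.
              \<forall>q \<in> cylindrical (frontier (ball 0 \<delta>)) {h}.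
        \<bar>vec_angle (p - 0) (q - vector [0, 0, h])\<bar> < \<eta> \<longrightarrow>
        Cr_norm r (\<lambda>x. Z p q x - X x) < ereal \<epsilon>))"
proof -
  let ?P = "cylindrical (frontier (ball 0 \<delta>)) {0}"
  let ?Q = "cylindrical (frontier (ball 0 \<delta>)) {h}"
  define b where "b = bump 0 h"
  obtain B where B: "\<And>z. (B has_real_derivative b z) (at z)"
    using ex_antiderivative[of b] bump_differentiable differentiable_imp_continuous_within
    unfolding b_def by blast
  have "B 0 < B h"
  proof (rule DERIV_pos_imp_increasing_open[OF \<open>h > 0\<close>])
    show "\<exists>y. (B has_real_derivative y) (at z) \<and> 0 < y" if "0 < z" "z < h" for z
      using B that bump_pos[of z 0 h] by (auto simp: b_def)
    show "continuous_on {0..h} B"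
      using B DERIV_isCont continuous_at_imp_continuous_on by blast
  qed
  have in_shell: "\<delta>\<^sup>2 \<in> {(\<delta> - \<xi>)\<^sup>2<..<(\<delta> + \<xi>)\<^sup>2}"
    using assms by (auto intro!: power_strict_mono)
  (* N makes the orbits at distance \<delta> from the axis turn by exactly \<theta> in the field F \<theta> below *)
  define N where "N = bump ((\<delta> - \<xi>)\<^sup>2) ((\<delta> + \<xi>)\<^sup>2) (\<delta>\<^sup>2) * (B h - B 0)"
  have "N > 0"
    using bump_pos[OF in_shell] \<open>B 0 < B h\<close> by (simp add: N_def)
  define a where "a s = bump ((\<delta> - \<xi>)\<^sup>2) ((\<delta> + \<xi>)\<^sup>2) s / N" for s
  have a1: "a (\<delta>\<^sup>2) * (B h - B 0) = 1"
    using \<open>N > 0\<close> by (simp add: a_def) (simp add: N_def)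
  define F where "F \<theta> = twist_field (\<lambda>s. \<theta> * a s) b" for \<theta>
  define W :: "real^3 \<Rightarrow> real^3" where
    "W x = vector [- (a (sqradius x) * b (x $ 3) * x $ 2), a (sqradius x) * b (x $ 3) * x $ 1, 0]" for x
  have F_minus_X: "F \<theta> x - X x = \<theta> *\<^sub>R W x" for \<theta> x
    by (simp add: F_def W_def X twist_field_def vec_eq_iff forall_3)
  note alg = smooth_algebra.mult smooth_algebra.add smooth_algebra.const smooth_algebra_uminus
    smooth_algebra_bump smooth_algebra_nth
  have k_smooth: "(\<lambda>x. a (sqradius x) * b (x $ 3)) \<in> smooth_algebra"
    unfolding a_def b_def sqradius_def divide_inverse power2_eq_square by (intro alg)
  have W_smooth: "smooth_field W"
  proof (rule smooth_algebra_imp_smooth_field)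
    show "(\<lambda>x. W x $ i) \<in> smooth_algebra" for i
      using exhaust_3[of i] by (auto simp: W_def intro!: alg k_smooth)
  qed
  have F_smooth: "smooth_field (F \<theta>)" for \<theta>
  proof (rule smooth_algebra_imp_smooth_field)
    have F: "F \<theta> x = \<theta> *\<^sub>R W x + vector [0, 0, 1]" for x
      using F_minus_X[of \<theta> x] by (simp add: X algebra_simps)
    show "(\<lambda>x. F \<theta> x $ i) \<in> smooth_algebra" for i
      using exhaust_3[of i] by (auto simp: F W_def intro!: alg k_smooth)
  qed
  have off_ring: "W x = 0" if "x \<notin> cylinder_ring 0 \<delta> h \<xi>" for x
  proof -
    let ?n = "norm (horizontal x)"
    (* the heights 0 and h belong to the ring, but b vanishes there as well *)
    have "?n \<le> \<delta> - \<xi> \<or> ?n \<ge> \<delta> + \<xi> \<or> x $ 3 \<notin> {0<..<h}"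
      using that by (force simp: cylinder_ring_def cylindrical_def)
    then have "a (sqradius x) = 0 \<or> b (x $ 3) = 0"
    proof (elim disjE)
      assume "?n \<le> \<delta> - \<xi>"
      then have "sqradius x \<le> (\<delta> - \<xi>)\<^sup>2"
        unfolding horizontal_norm[symmetric] by (intro power_mono) auto
      then show ?thesis by (simp add: a_def bump_eq_0)
    next
      assume "?n \<ge> \<delta> + \<xi>"
      then have "sqradius x \<ge> (\<delta> + \<xi>)\<^sup>2"
        unfolding horizontal_norm[symmetric] using assms by (intro power_mono) auto
      then show ?thesis by (simp add: a_def bump_eq_0)
    next
      assume "x $ 3 \<notin> {0<..<h}"
      then show ?thesis by (simp add: b_def bump_eq_0)
    qed
    then show ?thesis by (auto simp: W_def vec_eq_iff forall_3)
  qed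
  have W_supp: "W x = 0" if "x \<notin> cball 0 (\<delta> + \<xi> + h)" for x
  proof (rule off_ring, rule notI)
    assume "x \<in> cylinder_ring 0 \<delta> h \<xi>"
    then have "norm (horizontal x) < \<delta> + \<xi>" and "0 \<le> x $ 3" "x $ 3 \<le> h"
      by (auto simp: cylinder_ring_def cylindrical_def)
    then have "(norm (horizontal x))\<^sup>2 \<le> (\<delta> + \<xi>)\<^sup>2" "(x $ 3)\<^sup>2 \<le> h\<^sup>2"
      by (auto intro!: power_mono)
    then have "sqradius x + (x $ 3)\<^sup>2 \<le> (\<delta> + \<xi>)\<^sup>2 + h\<^sup>2"
      by (simp add: horizontal_norm)
    also have "\<dots> \<le> (\<delta> + \<xi> + h)\<^sup>2"
      using assms by (simp add: power2_sum)
    also have "sqradius x + (x $ 3)\<^sup>2 = (norm x)\<^sup>2"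
      unfolding power2_norm_eq_inner by (simp add: inner_vec_def sum_3 sqradius_def power2_eq_square)
    finally have "norm x \<le> \<delta> + \<xi> + h"
      using assms by (simp add: power2_le_iff_abs_le)
    with that show False by simp
  qed
  have "\<exists>\<theta>. \<bar>\<theta>\<bar> = \<bar>vec_angle (p - 0) (q - vector [0, 0, h])\<bar> \<and> rotate_lift \<theta> h p = q"
    if "p \<in> ?P" "q \<in> ?Q" for p q
  proof -
    have sq: "sqradius x = \<delta>\<^sup>2" "x $ 3 = t" if "x \<in> cylindrical (frontier (ball 0 \<delta>)) {t}" for x t
      using that \<open>\<delta> > 0\<close> by (auto simp: cylindrical_def horizontal_norm[symmetric])
    have "sqradius (q - vector [0, 0, h]) = \<delta>\<^sup>2" "(q - vector [0, 0, h]) $ 3 = 0"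
      using sq[OF \<open>q \<in> ?Q\<close>] by (simp_all add: sqradius_def)
    from exists_rotation_by_vec_angle[OF sq(2,1)[OF \<open>p \<in> ?P\<close>] this(2,1) \<open>\<delta> > 0\<close>, of h]
    show ?thesis by simp
  qed
  then obtain \<theta> where \<theta>: "\<And>p q. p \<in> ?P \<Longrightarrow> q \<in> ?Q \<Longrightarrow>
      \<bar>\<theta> p q\<bar> = \<bar>vec_angle (p - 0) (q - vector [0, 0, h])\<bar> \<and> rotate_lift (\<theta> p q) h p = q"
    by metis
  show ?thesis
  proof (intro exI[of _ "\<lambda>p q. F (\<theta> p q)"] conjI ballI allI impI)
    fix p q assume pq: "p \<in> ?P" "q \<in> ?Q"
    show "smooth_field (F (\<theta> p q))" by (rule F_smooth)
    have "(\<lambda>s. c * a s) differentiable (at s)" for c s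
      unfolding a_def using \<open>N > 0\<close> by (intro derivative_intros bump_differentiable) auto
    then show "preserves_volume_form (F (\<theta> p q))"
      unfolding F_def by (intro twist_field_preserves_volume[OF B])
    show "F (\<theta> p q) x = X x" if "x \<notin> cylinder_ring 0 \<delta> h \<xi>" for x
      using F_minus_X[of "\<theta> p q" x] off_ring[OF that] by simp
    have "p $ 3 = 0" "sqradius p = \<delta>\<^sup>2"
      using pq(1) \<open>\<delta> > 0\<close> by (auto simp: cylindrical_def horizontal_norm[symmetric])
    then show "q \<in> positive_orbit (F (\<theta> p q)) p"
      unfolding F_def using \<theta>[OF pq] \<open>h > 0\<close> a1
      by (intro twist_flow_joins[OF B, of h _ _ "\<theta> p q"]) (simp_all add: mult.assoc)
  next
    fix r :: nat and \<epsilon> :: real assume "\<epsilon> > 0"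
    obtain M where "M \<ge> 0" and M: "\<And>c. Cr_norm r (\<lambda>x. c *\<^sub>R W x) \<le> ereal (\<bar>c\<bar> * M)"
      using Cr_norm_scaleR_le[OF W_smooth compact_cball W_supp] by blast
    show "\<exists>\<eta>>0. \<forall>p \<in> ?P. \<forall>q \<in> ?Q. \<bar>vec_angle (p - 0) (q - vector [0, 0, h])\<bar> < \<eta> \<longrightarrow>
        Cr_norm r (\<lambda>x. F (\<theta> p q) x - X x) < ereal \<epsilon>"
    (* M may be 0, so the threshold divides by M + 1 *)
    proof (intro exI[of _ "\<epsilon> / (M + 1)"] conjI ballI impI)
      show "\<epsilon> / (M + 1) > 0" using \<open>\<epsilon> > 0\<close> \<open>M \<ge> 0\<close> by simp
      fix p q assume pq: "p \<in> ?P" "q \<in> ?Q"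
        and small: "\<bar>vec_angle (p - 0) (q - vector [0, 0, h])\<bar> < \<epsilon> / (M + 1)"
      have "\<bar>\<theta> p q\<bar> * M \<le> \<bar>\<theta> p q\<bar> * (M + 1)"
        by (simp add: mult_left_mono)
      also have "\<dots> < \<epsilon>"
        using small \<theta>[OF pq] \<open>M \<ge> 0\<close> by (simp add: pos_less_divide_eq)
      finally show "Cr_norm r (\<lambda>x. F (\<theta> p q) x - X x) < ereal \<epsilon>"
        unfolding F_minus_X using M[of "\<theta> p q"] by (meson ereal_less_eq(3) le_less_trans less_ereal.simps(1))
    qed
  qed
qed

end
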